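(* Let $G$ be a finite simple graph without isolated vertices, with independence number $\alpha$. (1) The multiplicity of the eigenvalue $1$ of the normalized signless 1-Laplacian, i.e. $\#\{k: c_k=1\}$, is at least $\alpha$ and at most the edge covering number of $G$. (2) If moreover $G$ is connected and bipartite, this multiplicity equals $\alpha$.
   Context: $d_i$ degree. $I^+(\vec x)=\sum_{\{i,j\}\in E}|x_i+x_j|$, $X=\{\vec x\in\mathbb{R}^n:\sum_i d_i|x_i|=1\}$, $c_k=\inf\{\sup_{\vec x\in A}I^+(\vec x):A\subseteq X\text{ compact}, A=-A,\gamma(A)\ge k\}$, $k=1,\dots,n$, with $\gamma$ the Krasnoselskii genus (least $m$ admitting a continuous odd map $A\to\mathbb{R}^m\setminus\{0\}$). The independence number is the largest size of a set of pairwise non-adjacent vertices; the edge covering number is the least number of edges whose union of endpoints is $V$. *)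

theory Defs
  imports "HOL-Analysis.Analysis" "HOL-Library.Extended_Nat"
begin

text \<open>
  A graph is given by its set of edges, each edge being the set of its endpoints. The vertices
  are all elements of the finite type \<open>'n\<close>, so that \<open>n = CARD('n)\<close> and
  \<open>real ^ 'n\<close> is the space of real vectors indexed by the vertices.
\<close>

definition simple_graph :: "('n::finite) set set \<Rightarrow> bool" where
  "simple_graph E \<longleftrightarrow> (\<forall>e\<in>E. card e = 2)"

definition no_isolated_vertices :: "('n::finite) set set \<Rightarrow> bool" where
  "no_isolated_vertices E \<longleftrightarrow> (\<forall>v. \<exists>e\<in>E. v \<in> e)"

definition degree :: "('n::finite) set set \<Rightarrow> 'n \<Rightarrow> nat" where
  "degree E v = card {e \<in> E. v \<in> e}"

definition connected_graph :: "('n::finite) set set \<Rightarrow> bool" where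
  "connected_graph E \<longleftrightarrow> (\<forall>u v. (u, v) \<in> {(i, j). {i, j} \<in> E}\<^sup>*)"

definition bipartite :: "('n::finite) set set \<Rightarrow> bool" where
  "bipartite E \<longleftrightarrow>
     (\<exists>L R. L \<union> R = UNIV \<and> L \<inter> R = {} \<and> (\<forall>e\<in>E. \<exists>i\<in>L. \<exists>j\<in>R. e = {i, j}))"

definition independent_set :: "('n::finite) set set \<Rightarrow> 'n set \<Rightarrow> bool" where
  "independent_set E S \<longleftrightarrow> (\<forall>i\<in>S. \<forall>j\<in>S. {i, j} \<notin> E)"

definition independence_number :: "('n::finite) set set \<Rightarrow> nat" where
  "independence_number E = Max (card ` {S. independent_set E S})"

definition edge_cover :: "('n::finite) set set \<Rightarrow> 'n set set \<Rightarrow> bool" where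
  "edge_cover E F \<longleftrightarrow> F \<subseteq> E \<and> \<Union>F = UNIV"

text \<open>Edge covers exist exactly when there are no isolated vertices.\<close>

definition edge_covering_number :: "('n::finite) set set \<Rightarrow> nat" where
  "edge_covering_number E = Min (card ` {F. edge_cover E F})"

text \<open>
  For an edge \<open>e = {i, j}\<close> with \<open>i \<noteq> j\<close>, the inner sum is \<open>x $ i + x $ j\<close>.
\<close>

definition I_plus :: "('n::finite) set set \<Rightarrow> real ^ 'n \<Rightarrow> real" where
  "I_plus E x = (\<Sum>e\<in>E. \<bar>\<Sum>i\<in>e. x $ i\<bar>)"

definition X_set :: "('n::finite) set set \<Rightarrow> (real ^ 'n) set" where
  "X_set E = {x. (\<Sum>i\<in>UNIV. real (degree E i) * \<bar>x $ i\<bar>) = 1}"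

text \<open>
  \<open>Euclidean_space m\<close> is the library's \<open>m\<close>-dimensional Euclidean space for a number \<open>m\<close>: the
  sequences \<open>nat \<Rightarrow> real\<close> vanishing from index \<open>m\<close> on, with the product topology.
\<close>

definition odd_map_to_punctured_space :: "(real ^ 'n::finite) set \<Rightarrow> nat \<Rightarrow> bool" where
  "odd_map_to_punctured_space A m \<longleftrightarrow>
     (\<exists>f. continuous_map (top_of_set A) (Euclidean_space m) f \<and>
          (\<forall>x\<in>A. f x \<noteq> (\<lambda>i. 0)) \<and>
          (\<forall>x\<in>A. f (- x) = (\<lambda>i. - f x i)))"

text \<open>
  The genus of the empty set is \<open>0\<close>, and it is \<open>\<infinity>\<close> (the infimum of the empty set) if there is
  no map as above for any \<open>m\<close>.
\<close>

definition genus :: "(real ^ 'n::finite) set \<Rightarrow> enat" where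
  "genus A = Inf (enat ` {m. odd_map_to_punctured_space A m})"

text \<open>
  The suprema and infima below are taken in the reals. For \<open>1 \<le> k \<le> CARD('n)\<close> and a graph without
  isolated vertices the sets \<open>A\<close> are nonempty and compact, so that the continuous function
  \<open>I_plus E\<close> is bounded on them, the family of all \<open>A\<close> is nonempty as it contains \<open>X_set E\<close>, and
  the suprema are bounded below by \<open>0\<close>.
\<close>

definition minmax_eigenvalue :: "('n::finite) set set \<Rightarrow> nat \<Rightarrow> real" where
  "minmax_eigenvalue E k =
     Inf {Sup (I_plus E ` A) | A.
            A \<subseteq> X_set E \<and> compact A \<and> A = uminus ` A \<and> enat k \<le> genus A}"

definition multiplicity_minmax :: "('n::finite) set set \<Rightarrow> real \<Rightarrow> nat" where
  "multiplicity_minmax E c = card {k \<in> {1..CARD('n)}. minmax_eigenvalue E k = c}"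

end

theory Submission
  imports Defs "HOL-Homology.Homology"
begin

text \<open>
  On \<open>X_set E\<close> one has \<open>I_plus E x \<le> 1\<close>, with equality iff the endpoints of no edge carry
  values of opposite signs; hence \<open>c\<^sub>k \<le> 1\<close> as soon as \<open>X_set E\<close> itself has genus \<open>n\<close>. If \<open>S\<close> is
  independent, then \<open>I_plus E = 1\<close> at the points supported in \<open>S\<close>, and a set of genus larger than
  \<open>n - |S|\<close> contains such a point, because otherwise the projection to the coordinates outside \<open>S\<close>
  would be an odd map to a punctured space of dimension \<open>n - |S|\<close>. If \<open>F\<close> is an edge cover, then
  \<open>I_plus E < 1\<close> on the section of \<open>X_set E\<close> by the subspace \<open>x\<^sub>i + x\<^sub>j = 0\<close> (\<open>{i, j} \<in> F\<close>), whose
  genus is at least \<open>n - |F|\<close>. For bipartite graphs a minimum edge cover and a maximum independent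
  set have the same size by the theorems of Koenig and Gallai, obtained here from Hall's theorem.

  The genus bounds are the Borsuk--Ulam theorem. It follows from Borsuk's theorem that an odd
  self-map of a sphere has odd degree, by induction on the dimension: the degrees of an odd map and
  of its restriction to the equator agree modulo 2 if the equator is preserved, and every odd map
  can be deformed into one that preserves it.
\<close>

subsection \<open>The Borsuk--Ulam theorem\<close>

abbreviation sph :: "nat \<Rightarrow> (nat \<Rightarrow> real) set" where
  "sph n \<equiv> topspace (nsphere n)"

lemma sph_eq: "sph n = {x. (\<Sum>i\<le>n. (x i)\<^sup>2) = 1 \<and> (\<forall>i>n. x i = 0)}"
  by (simp add: nsphere)

lemma nsphere_eq_top_of_set: "nsphere n = top_of_set (sph n)"
  by (simp add: nsphere euclidean_product_topology)

lemma continuous_map_nsphere_iff: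
  "continuous_map (nsphere m) (nsphere n) f \<longleftrightarrow> continuous_on (sph m) f \<and> f \<in> sph m \<rightarrow> sph n"
  by (subst (1 2) nsphere_eq_top_of_set) (simp add: image_subset_iff_funcset)

lemma sph_uminus: "x \<in> sph n \<Longrightarrow> - x \<in> sph n"
  by (simp add: sph_eq)

lemma sph_mono: "m \<le> n \<Longrightarrow> x \<in> sph m \<Longrightarrow> x \<in> sph n"
proof -
  assume "m \<le> n" and x: "x \<in> sph m"
  have "(\<Sum>i\<le>n. (x i)\<^sup>2) = (\<Sum>i\<le>m. (x i)\<^sup>2)"
    using \<open>m \<le> n\<close> x by (intro sum.mono_neutral_right) (auto simp: sph_eq)
  then show ?thesis using x \<open>m \<le> n\<close> by (simp add: sph_eq)
qed

lemma sph_nonzero: "x \<in> sph n \<Longrightarrow> \<exists>i\<le>n. x i \<noteq> 0"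
  by (rule ccontr) (simp add: sph_eq)

text \<open>Where the first \<open>n + 1\<close> coordinates all vanish, division by zero yields the
  zero sequence; hence the range and continuity lemmas assume a nonzero coordinate.\<close>

definition radial :: "nat \<Rightarrow> (nat \<Rightarrow> real) \<Rightarrow> nat \<Rightarrow> real" where
  "radial n x = (\<lambda>i. x i / sqrt (\<Sum>j\<le>n. (x j)\<^sup>2))"

lemma radial_minus: "radial n (- x) = - radial n x"
  by (auto simp: radial_def)

lemma sum_squares_pos:
  fixes n :: nat
  assumes "\<exists>i\<le>n. x i \<noteq> (0::real)"
  shows "(\<Sum>j\<le>n. (x j)\<^sup>2) > 0"
proof -
  obtain i where "i \<le> n" "x i \<noteq> 0" using assms by blast
  then show ?thesis by (intro sum_pos2[of _ i]) auto
qed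

lemma radial_in_sph:
  assumes "\<exists>i\<le>n. x i \<noteq> 0" "\<forall>i>n. x i = 0"
  shows "radial n x \<in> sph n"
proof -
  have "(\<Sum>i\<le>n. (x i / sqrt (\<Sum>j\<le>n. (x j)\<^sup>2))\<^sup>2) = (\<Sum>i\<le>n. (x i)\<^sup>2 / (\<Sum>j\<le>n. (x j)\<^sup>2))"
    by (intro sum.cong) (simp_all add: power_divide sum_nonneg)
  also have "\<dots> = 1"
    using sum_squares_pos[OF assms(1)] by (simp flip: sum_divide_distrib)
  finally show ?thesis using assms(2) by (simp add: radial_def sph_eq)
qed

lemma radial_id: "x \<in> sph n \<Longrightarrow> radial n x = x"
  by (auto simp: radial_def sph_eq)

lemma continuous_on_radial:
  assumes "continuous_on S f" "\<And>x. x \<in> S \<Longrightarrow> \<exists>i\<le>n. f x i \<noteq> 0"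
  shows "continuous_on S (\<lambda>x. radial n (f x))"
  unfolding radial_def
proof (intro continuous_on_coordinatewise_then_product continuous_on_divide continuous_on_real_sqrt
    continuous_on_sum continuous_on_power continuous_on_product_then_coordinatewise[OF assms(1)] ballI)
  fix x assume "x \<in> S"
  then show "sqrt (\<Sum>j\<le>n. (f x j)\<^sup>2) \<noteq> 0"
    using sum_squares_pos[OF assms(2)] by fastforce
qed

text \<open>The segment from \<open>f x\<close> to \<open>g x\<close> avoids the origin unless the
  two points are opposite, so the straight-line homotopy can be projected radially to the
  sphere.\<close>

lemma nonantipodal_homotopic:
  assumes f: "continuous_map (nsphere m) (nsphere n) f"
    and g: "continuous_map (nsphere m) (nsphere n) g"
    and na: "\<And>x. x \<in> sph m \<Longrightarrow> g x \<noteq> - f x"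
  shows "homotopic_with (\<lambda>x. True) (nsphere m) (nsphere n) f g"
proof -
  define h where "h = (\<lambda>p i. (1 - fst p) * f (snd p) i + fst p * g (snd p) i)"
  have fc: "continuous_on (sph m) f" and fs: "\<And>x. x \<in> sph m \<Longrightarrow> f x \<in> sph n"
    and gc: "continuous_on (sph m) g" and gs: "\<And>x. x \<in> sph m \<Longrightarrow> g x \<in> sph n"
    using f g by (auto simp: continuous_map_nsphere_iff)
  have nz: "\<exists>i\<le>n. h p i \<noteq> 0" if p: "p \<in> {0..1} \<times> sph m" for p
  proof (rule ccontr)
    assume "\<not> ?thesis"
    then have z: "\<And>i. i \<le> n \<Longrightarrow> h p i = 0" by auto
    obtain t x where px: "p = (t, x)" and t: "0 \<le> t" "t \<le> 1" and x: "x \<in> sph m"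
      using p by auto
    have z': "(1 - t) * f x i = - (t * g x i)" if "i \<le> n" for i
      using z[OF that] by (simp add: h_def px)
    \<comment> \<open>Comparing the lengths of both sides of \<open>z'\<close> forces
      \<open>t = 1/2\<close>, and then \<open>g x = - f x\<close>.\<close>
    have "(1 - t)\<^sup>2 * (\<Sum>i\<le>n. (f x i)\<^sup>2) = t\<^sup>2 * (\<Sum>i\<le>n. (g x i)\<^sup>2)"
      unfolding sum_distrib_left power_mult_distrib[symmetric] using z' by (intro sum.cong) auto
    then have "(1 - t)\<^sup>2 = t\<^sup>2"
      using fs[OF x] gs[OF x] by (simp add: sph_eq)
    then have "1 - t = t" using t by (simp add: power2_eq_iff_nonneg)
    then have "t = 1/2" by linarith
    from z'[unfolded this] have "g x i = - f x i" if "i \<le> n" for i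
      using that by simp
    moreover have "g x i = - f x i" if "\<not> i \<le> n" for i
      using fs[OF x] gs[OF x] that by (simp add: sph_eq)
    ultimately have "g x = - f x" by (auto simp: fun_eq_iff)
    with na[OF x] show False by simp
  qed
  have hc: "continuous_on ({0..1} \<times> sph m) h"
    unfolding h_def
    by (intro continuous_on_coordinatewise_then_product continuous_intros
        continuous_on_compose2[OF continuous_on_product_then_coordinatewise[OF fc]]
        continuous_on_compose2[OF continuous_on_product_then_coordinatewise[OF gc]]) auto
  have "radial n (h p) \<in> sph n" if "p \<in> {0..1} \<times> sph m" for p
  proof (rule radial_in_sph[OF nz[OF that]])
    show "\<forall>i>n. h p i = 0"
      using that fs[of "snd p"] gs[of "snd p"] by (auto simp: h_def sph_eq)
  qed
  moreover have "continuous_on ({0..1} \<times> sph m) (\<lambda>p. radial n (h p))"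
    by (rule continuous_on_radial[OF hc nz])
  moreover have "prod_topology (top_of_set {0..1}) (nsphere m) = top_of_set ({0..1::real} \<times> sph m)"
    by (subst nsphere_eq_top_of_set) (simp flip: subtopology_Times)
  ultimately have "continuous_map (prod_topology (top_of_set {0..1}) (nsphere m)) (nsphere n) (\<lambda>p. radial n (h p))"
    by (subst nsphere_eq_top_of_set[of n]) (auto simp: image_subset_iff)
  moreover have "radial n (h (0, x)) = f x" "radial n (h (1, x)) = g x" if "x \<in> sph m" for x
    using radial_id[OF fs[OF that]] radial_id[OF gs[OF that]] by (simp_all add: h_def)
  ultimately show ?thesis
    by (subst homotopic_with) auto
qed

section \<open>Reflections of the sphere and the degree of odd maps\<close>

definition reflect :: "nat \<Rightarrow> (nat \<Rightarrow> real) \<Rightarrow> (nat \<Rightarrow> real) \<Rightarrow> nat \<Rightarrow> real" where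
  "reflect n w x = (\<lambda>i. x i - 2 * (\<Sum>j\<le>n. x j * w j) / (\<Sum>j\<le>n. (w j)\<^sup>2) * w i)"

lemma reflect_minus: "reflect n w (- x) = - reflect n w x"
  by (auto simp: reflect_def sum_negf fun_eq_iff)

lemma continuous_on_reflect: "continuous_on S (reflect n w)"
  unfolding reflect_def divide_inverse
  by (intro continuous_on_coordinatewise_then_product continuous_intros
        continuous_on_product_then_coordinatewise[OF continuous_on_id])

lemma reflect_in_sph:
  assumes x: "x \<in> sph n" and w: "\<forall>i>n. w i = 0"
  shows "reflect n w x \<in> sph n"
proof -
  define a where "a = (\<Sum>j\<le>n. x j * w j)"
  define b where "b = (\<Sum>j\<le>n. (w j)\<^sup>2)"
  define c where "c = 2 * a / b"
  have "(\<Sum>i\<le>n. (reflect n w x i)\<^sup>2) = (\<Sum>i\<le>n. (x i)\<^sup>2 - 2 * c * (x i * w i) + c\<^sup>2 * (w i)\<^sup>2)"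
    unfolding reflect_def a_def[symmetric] b_def[symmetric] c_def[symmetric]
    by (intro sum.cong) (simp_all add: power2_eq_square algebra_simps)
  also have "\<dots> = (\<Sum>i\<le>n. (x i)\<^sup>2) - 2 * c * a + c\<^sup>2 * b"
    by (simp add: sum.distrib sum_subtractf a_def b_def flip: sum_distrib_left)
  also have "\<dots> = (\<Sum>i\<le>n. (x i)\<^sup>2)"
    unfolding c_def by (cases "b = 0") (simp_all add: power2_eq_square)
  finally show ?thesis
    using x w by (simp add: sph_eq reflect_def)
qed

lemma reflect_reflect: "reflect n w (reflect n w x) = x"
proof -
  define a where "a = (\<Sum>j\<le>n. x j * w j)"
  define b where "b = (\<Sum>j\<le>n. (w j)\<^sup>2)"
  define c where "c = 2 * a / b"
  have r: "reflect n w x = (\<lambda>i. x i - c * w i)"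
    by (simp add: reflect_def a_def b_def c_def)
  have "(\<Sum>j\<le>n. (x j - c * w j) * w j) = (\<Sum>j\<le>n. x j * w j - c * (w j)\<^sup>2)"
    by (intro sum.cong) (simp_all add: power2_eq_square algebra_simps)
  also have "\<dots> = a - c * b"
    by (simp add: sum_subtractf a_def b_def flip: sum_distrib_left)
  finally have "2 * (\<Sum>j\<le>n. (x j - c * w j) * w j) / b = - c"
    by (cases "b = 0") (simp_all add: c_def diff_divide_distrib)
  then show ?thesis
    unfolding r unfolding reflect_def b_def[symmetric] by simp
qed

text \<open>Since \<open>u\<close> and \<open>v\<close> have equal length, the squared length of
  \<open>v - u\<close> is \<open>-2\<close> times its inner product with \<open>u\<close>, so the
  reflection adds exactly \<open>v - u\<close>. It serves to move a chosen point of the sphere to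
  the pole.\<close>

lemma reflect_diff:
  assumes u: "u \<in> sph n" and v: "v \<in> sph n"
  shows "reflect n (v - u) u = v"
proof (cases "u = v")
  case True
  then show ?thesis by (simp add: reflect_def)
next
  case False
  define a where "a = (\<Sum>j\<le>n. u j * (v - u) j)"
  define b where "b = (\<Sum>j\<le>n. ((v - u) j)\<^sup>2)"
  have "b = (\<Sum>j\<le>n. (v j)\<^sup>2 - (u j)\<^sup>2 - 2 * (u j * (v - u) j))"
    unfolding b_def by (intro sum.cong) (simp_all add: power2_eq_square algebra_simps)
  also have "\<dots> = - 2 * a"
    using u v unfolding a_def by (simp add: sum_subtractf sph_eq flip: sum_distrib_left)
  finally have "b = - 2 * a" .
  moreover have "b > 0"
  proof -
    obtain i where i: "v i \<noteq> u i" using False by force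
    then have "i \<le> n" using u v by (auto simp: sph_eq) (metis not_le)
    then show ?thesis unfolding b_def using i by (intro sum_squares_pos) auto
  qed
  ultimately have "2 * a / b = - 1" by (simp add: field_simps)
  then show ?thesis
    unfolding reflect_def a_def[symmetric] b_def[symmetric] by simp
qed

text \<open>A normalized odd polynomial approximation of \<open>f\<close> is smooth, so it cannot
  map the equator onto the whole sphere. The type \<open>'a\<close> provides a Euclidean space in
  which to speak of polynomials and differentiability.\<close>

lemma odd_map_approximation:
  assumes n: "Suc n < DIM('a::euclidean_space)"
    and f: "continuous_map (nsphere (Suc n)) (nsphere (Suc n)) f"
    and odd: "\<And>x. x \<in> sph (Suc n) \<Longrightarrow> f (- x) = - f x"
  obtains P v where "continuous_map (nsphere (Suc n)) (nsphere (Suc n)) P"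
    and "\<And>x. x \<in> sph (Suc n) \<Longrightarrow> P (- x) = - P x"
    and "\<And>x. x \<in> sph (Suc n) \<Longrightarrow> P x \<noteq> - f x"
    and "v \<in> sph (Suc n)" and "\<And>x. x \<in> sph n \<Longrightarrow> P x \<noteq> v"
proof -
  define N where "N = DIM('a)"
  obtain b :: "nat \<Rightarrow> 'a" where b: "bij_betw b {0..<N} Basis"
    unfolding N_def using ex_bij_betw_nat_finite[OF finite_Basis] by blast
  have bB: "b i \<in> Basis" if "i < N" for i
    using b that by (auto simp: bij_betw_def)
  have bb: "b i \<bullet> b j = (if i = j then 1 else 0)" if "i < N" "j < N" for i j
    using b that bB by (auto simp: bij_betw_def inj_on_def inner_Basis)
  \<comment> \<open>\<open>emb\<close> and \<open>crd\<close> translate between sequences and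
    vectors of \<open>'a\<close>; \<open>T j\<close> is spanned by \<open>b 0\<close> to
    \<open>b j\<close> for \<open>j < N\<close>, so its unit sphere corresponds to
    \<open>sph j\<close>.\<close>
  define emb where "emb = (\<lambda>x. \<Sum>i<N. x i *\<^sub>R b i)"
  define crd where "crd = (\<lambda>v i. if i < N then v \<bullet> b i else 0)"
  define T where "T = (\<lambda>j. {v. \<forall>i. j < i \<and> i < N \<longrightarrow> v \<bullet> b i = 0})"
  have emb_b: "emb x \<bullet> b i = x i" if "i < N" for x i
    using that by (simp add: emb_def inner_sum_left bb if_distrib cong: if_cong)
  have emb_crd: "emb (crd v) = v" for v
  proof -
    have "emb (crd v) = (\<Sum>i\<in>{0..<N}. (v \<bullet> b i) *\<^sub>R b i)"
      unfolding emb_def crd_def by (intro sum.cong) auto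
    also have "\<dots> = (\<Sum>u\<in>Basis. (v \<bullet> u) *\<^sub>R u)"
      by (rule sum.reindex_bij_betw[OF b, of "\<lambda>u. (v \<bullet> u) *\<^sub>R u"])
    finally show ?thesis by (simp add: euclidean_representation)
  qed
  have crd_emb: "crd (emb x) = x" if "x \<in> sph k" "k < N" for x k
    using that emb_b by (auto simp: crd_def fun_eq_iff sph_eq)
  have emb_minus: "emb (- x) = - emb x" for x
    by (simp add: emb_def sum_negf)
  have crd_minus: "crd (- v) = - crd v" for v
    by (auto simp: crd_def fun_eq_iff)
  have subT: "subspace (T j)" for j
    by (auto simp: T_def subspace_def inner_add_left)
  have norm_crd: "(\<Sum>i\<le>k. (crd v i)\<^sup>2) = (norm v)\<^sup>2" if "v \<in> T k" "k < N" for v k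
  proof -
    have "(\<Sum>i\<le>k. (crd v i)\<^sup>2) = (\<Sum>i\<in>{0..<N}. (v \<bullet> b i)\<^sup>2)"
      using that by (intro sum.mono_neutral_cong_left) (auto simp: T_def crd_def)
    also have "\<dots> = (\<Sum>u\<in>Basis. (v \<bullet> u)\<^sup>2)"
      by (rule sum.reindex_bij_betw[OF b, of "\<lambda>u. (v \<bullet> u)\<^sup>2"])
    also have "\<dots> = (norm v)\<^sup>2"
      unfolding power2_norm_eq_inner by (subst euclidean_inner) (simp add: power2_eq_square)
    finally show ?thesis .
  qed
  have crd_sph: "crd v \<in> sph k" if "v \<in> sphere 0 1 \<inter> T k" "k < N" for v k
    using norm_crd[of v k] that by (auto simp: sph_eq crd_def T_def)
  have emb_sph: "emb x \<in> sphere 0 1 \<inter> T k" if "x \<in> sph k" "k < N" for x k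
  proof -
    have T: "emb x \<in> T k" using that emb_b by (auto simp: T_def sph_eq)
    have "(norm (emb x))\<^sup>2 = 1"
      using norm_crd[OF T \<open>k < N\<close>] that by (simp add: crd_emb sph_eq)
    then have "norm (emb x) = 1" unfolding abs_square_eq_1 by simp
    then show ?thesis using T by simp
  qed
  define m where "m = Suc n"
  have mN: "m < N" "n < N" using n by (auto simp: m_def N_def)
  define S where "S = sphere 0 1 \<inter> T m"
  have cT: "closed (T m)" using subT closed_subspace by blast
  then have compS: "compact S" by (auto simp: S_def)
  have Smin: "- v \<in> S" if "v \<in> S" for v
    using that subT subspace_neg by (auto simp: S_def)
  define F where "F = emb \<circ> f \<circ> crd"
  have fc: "continuous_on (sph m) f" and fs: "\<And>x. x \<in> sph m \<Longrightarrow> f x \<in> sph m"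
    using f by (auto simp: continuous_map_nsphere_iff m_def)
  have ccrd: "continuous_on A crd" for A
    unfolding crd_def
  proof (rule continuous_on_coordinatewise_then_product)
    show "continuous_on A (\<lambda>x. if i < N then x \<bullet> b i else 0)" for i
      by (cases "i < N") (simp_all add: continuous_on_inner[OF continuous_on_id continuous_on_const])
  qed
  have cemb: "continuous_on A emb" for A
    unfolding emb_def by (intro continuous_intros continuous_on_product_then_coordinatewise[OF continuous_on_id])
  have Fc: "continuous_on S F"
    unfolding F_def
    by (intro continuous_on_compose ccrd cemb continuous_on_subset[OF fc])
      (use crd_sph mN in \<open>auto simp: S_def\<close>)
  have FS: "F v \<in> S" if "v \<in> S" for v
    using emb_sph[OF fs[OF crd_sph[OF that[unfolded S_def] mN(1)]] mN(1)] by (simp add: F_def S_def)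
  have Fodd: "F (- v) = - F v" if "v \<in> S" for v
    using that crd_sph[of v m] mN odd by (simp add: F_def S_def crd_minus emb_minus m_def)
  obtain g where g: "polynomial_function g" "g ` S \<subseteq> T m"
    and gF: "\<And>x. x \<in> S \<Longrightarrow> norm (F x - g x) < 1/2"
    using Stone_Weierstrass_polynomial_function_subspace[OF compS Fc _ subT, of "1/2" m] FS
    by (auto simp: S_def image_subset_iff)
  \<comment> \<open>The odd part of \<open>g\<close> is still within \<open>1/2\<close> of
    \<open>F\<close> because \<open>F\<close> is odd; as \<open>F\<close> has norm one on
    \<open>S\<close>, this keeps \<open>p\<close> away from zero.\<close>
  define p where "p = (\<lambda>v. (1/2) *\<^sub>R (g v - g (- v)))"
  have pp: "polynomial_function p"
  proof -
    have "polynomial_function (\<lambda>v. g (- v))"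
      using polynomial_function_compose[OF polynomial_function_minus[OF polynomial_function_id] g(1)]
      by (simp add: o_def)
    then show ?thesis unfolding p_def
      by (intro polynomial_function_cmul polynomial_function_diff g(1))
  qed
  have podd: "p (- v) = - p v" for v
    by (simp add: p_def algebra_simps)
  have pT: "p v \<in> T m" if "v \<in> S" for v
    unfolding p_def using that g(2) Smin[OF that] subT[of m]
    by (intro subspace_scale subspace_diff) auto
  have pF: "norm (F v - p v) < 1/2" if "v \<in> S" for v
  proof -
    have "F v - p v = (1/2) *\<^sub>R ((F v + F v) - (g v - g (- v)))"
      unfolding p_def scaleR_right_diff_distrib[of _ "F v + F v"] scaleR_half_double ..
    also have "(F v + F v) - (g v - g (- v)) = (F v - g v) - (F (- v) - g (- v))"
      by (simp add: Fodd[OF that])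
    also have "norm ((1/2) *\<^sub>R \<dots>) \<le> (1/2) * (norm (F v - g v) + norm (F (- v) - g (- v)))"
      by (simp add: norm_triangle_ineq4)
    also have "\<dots> < 1/2"
      using gF[OF that] gF[OF Smin[OF that]] by simp
    finally show ?thesis .
  qed
  have p0: "p v \<noteq> 0" if "v \<in> S" for v
    using pF[OF that] FS[OF that] by (auto simp: S_def)
  define Q where "Q = (\<lambda>v. inverse (norm (p v)) *\<^sub>R p v)"
  have QS: "Q v \<in> S" if "v \<in> S" for v
    using p0[OF that] pT[OF that] subT[of m] by (auto simp: Q_def S_def intro: subspace_scale)
  have Qodd: "Q (- v) = - Q v" for v
    by (simp add: Q_def podd)
  have Qc: "continuous_on S Q"
    unfolding Q_def using p0 pp
    by (intro continuous_intros continuous_on_polymonial_function) auto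
  \<comment> \<open>Otherwise \<open>p v\<close> would be a negative multiple of \<open>F v\<close>,
    hence at distance more than one from it.\<close>
  have QF: "Q v \<noteq> - F v" if "v \<in> S" for v
  proof
    assume "Q v = - F v"
    then have "norm (p v) *\<^sub>R Q v = - norm (p v) *\<^sub>R F v" by simp
    then have "p v = - norm (p v) *\<^sub>R F v"
      using p0[OF that] by (simp add: Q_def)
    then have "F v - p v = (1 + norm (p v)) *\<^sub>R F v"
      by (metis (no_types) add.commute diff_minus_eq_add scaleR_add_left scaleR_minus_left scaleR_one)
    then have "norm (F v - p v) = 1 + norm (p v)"
      using FS[OF that] by (simp add: S_def)
    then show False using pF[OF that] norm_ge_zero[of "p v"] by linarith
  qed
  have nm: "T n \<subseteq> T m" by (auto simp: T_def m_def)
  have "b m \<in> T m - T n"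
    using mN by (auto simp: T_def m_def bb)
  then have "dim (T n) < dim (T m)"
    using nm by (intro dim_psubset) (auto simp only: span_eq_iff[THEN iffD2, OF subT])
  \<comment> \<open>A differentiable map cannot carry the unit sphere of \<open>T n\<close> onto
    that of the higher-dimensional \<open>T m\<close>; a merely continuous map such as
    \<open>F\<close> could.\<close>
  moreover have "Q differentiable_on sphere 0 1 \<inter> T n"
    unfolding Q_def using p0 nm
    by (intro differentiable_on_scaleR differentiable_on_inverse
        differentiable_on_compose[where g = p and f = norm, unfolded o_def]
        differentiable_on_norm differentiable_on_polynomial_function pp) (auto simp: S_def)
  ultimately have "Q ` (sphere 0 1 \<inter> T n) \<noteq> sphere 0 1 \<inter> T m"
    by (intro spheremap_lemma1 subT nm)
  moreover have "Q ` (sphere 0 1 \<inter> T n) \<subseteq> sphere 0 1 \<inter> T m"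
    using QS nm by (auto simp: S_def)
  ultimately obtain w where w: "w \<in> S" "w \<notin> Q ` (sphere 0 1 \<inter> T n)"
    unfolding S_def by blast
  define P where "P = crd \<circ> Q \<circ> emb"
  have embS: "emb x \<in> S" if "x \<in> sph m" for x
    using emb_sph[OF that mN(1)] by (simp add: S_def)
  have crdS: "crd v \<in> sph m" if "v \<in> S" for v
    using crd_sph[of v m] that mN(1) by (simp add: S_def)
  show thesis
  proof
    show "continuous_map (nsphere (Suc n)) (nsphere (Suc n)) P"
      unfolding continuous_map_nsphere_iff P_def m_def[symmetric]
      by (intro conjI continuous_on_compose ccrd cemb continuous_on_subset[OF Qc])
        (auto simp: embS crdS QS)
    show "P (- x) = - P x" for x
      by (simp add: P_def emb_minus crd_minus Qodd)
    show "P x \<noteq> - f x" if x: "x \<in> sph (Suc n)" for x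
    proof
      assume "P x = - f x"
      then have "emb (P x) = - emb (f x)" by (simp add: emb_minus)
      then have "Q (emb x) = - F (emb x)"
        using crd_emb[OF x] mN by (simp add: P_def emb_crd F_def m_def)
      then show False using QF embS x m_def by blast
    qed
    show "crd w \<in> sph (Suc n)" using crdS w m_def by simp
    show "P x \<noteq> crd w" if "x \<in> sph n" for x
    proof
      assume "P x = crd w"
      then have "Q (emb x) = w" by (metis P_def comp_apply emb_crd)
      then show False using w emb_sph[OF that mN(2)] by blast
    qed
  qed
qed

text \<open>The induction on \<open>n\<close> runs below the dimension of a fixed type
  \<open>'a\<close>, which accommodates the smooth approximations of all steps.\<close>

theorem Borsuk_odd_mapping_degree:
  assumes "n < DIM('a::euclidean_space)"
    and f: "continuous_map (nsphere n) (nsphere n) f"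
    and odd: "\<And>x. x \<in> sph n \<Longrightarrow> f (- x) = - f x"
  shows "odd (Brouwer_degree2 n f)"
  using assms
proof (induction n arbitrary: f)
  case 0
  \<comment> \<open>\<open>sph 0\<close> consists of \<open>e\<close> and \<open>- e\<close>, so an
    odd self-map is the identity, of degree 1, or the swap \<open>?r\<close>, of degree -1.\<close>
  let ?r = "\<lambda>x::nat \<Rightarrow> real. \<lambda>i. if i = 0 then - x i else x i"
  define e :: "nat \<Rightarrow> real" where "e = (\<lambda>i. if i = 0 then 1 else 0)"
  have sph0: "x = e \<or> x = - e" if "x \<in> sph 0" for x
    using that by (auto simp: sph_eq e_def power2_eq_1_iff fun_eq_iff)
  have e: "e \<in> sph 0" by (simp add: sph_eq e_def)
  then have fe: "f e \<in> sph 0"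
    using "0.prems"(2) by (auto simp: continuous_map_nsphere_iff)
  have f_minus: "f (- e) = - f e" using "0.prems"(3) e by blast
  show ?case
  proof (cases "f e = e")
    case True
    have "Brouwer_degree2 0 f = Brouwer_degree2 0 id"
      using sph0 True f_minus by (intro Brouwer_degree2_eq) auto
    then show ?thesis by simp
  next
    case False
    then have "f e = - e" using sph0[OF fe] by blast
    moreover have "?r e = - e" "?r (- e) = e" "- (- e) = e" by (auto simp: e_def)
    ultimately have "f x = ?r x" if "x \<in> sph 0" for x
      using sph0[OF that] f_minus by auto
    then have "Brouwer_degree2 0 f = Brouwer_degree2 0 ?r"
      by (intro Brouwer_degree2_eq)
    then show ?thesis by (simp add: Brouwer_degree2_reflection)
  qed
next
  case (Suc n)
  obtain P v where P: "continuous_map (nsphere (Suc n)) (nsphere (Suc n)) P"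
    and P_minus: "\<And>x. x \<in> sph (Suc n) \<Longrightarrow> P (- x) = - P x"
    and P_na: "\<And>x. x \<in> sph (Suc n) \<Longrightarrow> P x \<noteq> - f x"
    and v: "v \<in> sph (Suc n)" and P_v: "\<And>x. x \<in> sph n \<Longrightarrow> P x \<noteq> v"
    using odd_map_approximation[OF Suc.prems] by blast
  define e :: "nat \<Rightarrow> real" where "e = (\<lambda>i. if i = Suc n then 1 else 0)"
  have e: "e \<in> sph (Suc n)" by (simp add: sph_eq e_def)
  \<comment> \<open>This reflection exchanges the pole \<open>e\<close> and the missed value
    \<open>v\<close>, so \<open>g\<close> below misses \<open>e\<close> on the equator and, being
    odd, also \<open>- e\<close>.\<close>
  define R where "R = reflect (Suc n) (v - e)"
  have Re: "R e = v" unfolding R_def by (rule reflect_diff[OF e v])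
  have RR: "R (R x) = x" for x unfolding R_def by (rule reflect_reflect)
  have R_minus: "R (- x) = - R x" for x unfolding R_def by (rule reflect_minus)
  have R: "continuous_map (nsphere (Suc n)) (nsphere (Suc n)) R"
    using e v unfolding continuous_map_nsphere_iff R_def
    by (intro conjI continuous_on_reflect funcsetI reflect_in_sph) (auto simp: sph_eq)
  define g where "g = R \<circ> P"
  have g: "continuous_map (nsphere (Suc n)) (nsphere (Suc n)) g"
    unfolding g_def by (rule continuous_map_compose[OF P R])
  have gc: "continuous_on (sph (Suc n)) g" and gs: "\<And>x. x \<in> sph (Suc n) \<Longrightarrow> g x \<in> sph (Suc n)"
    using g by (auto simp: continuous_map_nsphere_iff)
  have g_minus: "g (- x) = - g x" if "x \<in> sph (Suc n)" for x
    using P_minus[OF that] by (simp add: g_def R_minus)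
  have g_eq: "\<exists>i\<le>n. g x i \<noteq> 0" if x: "x \<in> sph n" for x
  proof (rule ccontr)
    assume "\<not> ?thesis"
    then have z: "\<And>i. i \<le> n \<Longrightarrow> g x i = 0" by blast
    have xS: "x \<in> sph (Suc n)" using sph_mono[OF _ x] by simp
    have "(g x (Suc n))\<^sup>2 = 1" using gs[OF xS] z by (simp add: sph_eq)
    moreover have "g x i = 0" if "i \<noteq> Suc n" for i
      using gs[OF xS] z[of i] that by (cases "i \<le> n") (auto simp: sph_eq)
    ultimately have "g x = e \<or> g x = - e"
      by (auto simp: power2_eq_1_iff e_def fun_eq_iff)
    then have "R (g x) = v \<or> R (g x) = - v" using Re R_minus by auto
    then have "P x = v \<or> P x = - v" by (simp add: g_def RR)
    then have "P x = v \<or> P (- x) = v" using P_minus[OF xS] by auto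
    then show False using P_v x sph_uminus by blast
  qed
  text \<open>Damping the last coordinate by the square of the last coordinate of the argument makes \<open>g\<close>
    preserve the equator; off the equator the damping factor is positive, so no zero is created.\<close>
  define s where "s = (\<lambda>x i. if i = Suc n then (x (Suc n))\<^sup>2 * g x i else g x i)"
  have s0: "\<exists>i\<le>Suc n. s x i \<noteq> 0" if x: "x \<in> sph (Suc n)" for x
  proof (cases "x (Suc n) = 0")
    case True
    then have "x \<in> sph n" using x by (auto simp: sph_eq le_Suc_eq) (metis Suc_lessI)
    then obtain i where "i \<le> n" "g x i \<noteq> 0" using g_eq by blast
    then show ?thesis by (intro exI[of _ i]) (simp add: s_def)
  next
    case False
    obtain i where "i \<le> Suc n" "g x i \<noteq> 0" using sph_nonzero[OF gs[OF x]] by blast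
    then show ?thesis using False by (intro exI[of _ i]) (auto simp: s_def)
  qed
  have sc: "continuous_on (sph (Suc n)) s"
    unfolding s_def
  proof (rule continuous_on_coordinatewise_then_product)
    show "continuous_on (sph (Suc n)) (\<lambda>x. if i = Suc n then (x (Suc n))\<^sup>2 * g x i else g x i)" for i
      using continuous_on_product_then_coordinatewise[OF gc, of i] continuous_on_product_then_coordinatewise[OF continuous_on_id]
      by (cases "i = Suc n") (auto intro!: continuous_on_mult continuous_on_power)
  qed
  define q where "q = (\<lambda>x. radial (Suc n) (s x))"
  have q: "continuous_map (nsphere (Suc n)) (nsphere (Suc n)) q"
    unfolding continuous_map_nsphere_iff q_def
  proof (intro conjI continuous_on_radial sc s0 funcsetI radial_in_sph)
    show "\<forall>i>Suc n. s x i = 0" if "x \<in> sph (Suc n)" for x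
      using gs[OF that] by (simp add: s_def sph_eq)
  qed
  have q_minus: "q (- x) = - q x" if "x \<in> sph (Suc n)" for x
  proof -
    have "s (- x) = - s x" using g_minus[OF that] by (auto simp: s_def fun_eq_iff)
    then show ?thesis by (simp add: q_def radial_minus)
  qed
  \<comment> \<open>Each coordinate of \<open>s x\<close> vanishes or has the sign of that
    coordinate of \<open>g x\<close>, so \<open>q x\<close> and \<open>g x\<close> cannot be
    opposite.\<close>
  have q_g: "q x \<noteq> - g x" if x: "x \<in> sph (Suc n)" for x
  proof
    assume eq: "q x = - g x"
    define c where "c = sqrt (\<Sum>j\<le>Suc n. (s x j)\<^sup>2)"
    have "c > 0" unfolding c_def using sum_squares_pos[OF s0[OF x]] by simp
    obtain i where i: "i \<le> Suc n" "s x i \<noteq> 0" using s0[OF x] by blast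
    have "s x i / c = - g x i"
      using fun_cong[OF eq, of i] by (simp add: q_def radial_def c_def)
    then have "s x i * (s x i / c) = s x i * (- g x i)" by (simp only:)
    then have "(s x i)\<^sup>2 / c = - (s x i * g x i)" by (simp add: power2_eq_square)
    moreover have "s x i * g x i \<ge> 0"
      by (simp add: s_def mult.assoc)
    moreover have "(s x i)\<^sup>2 / c > 0"
      using i \<open>c > 0\<close> by simp
    ultimately show False by linarith
  qed
  have q_eq: "q x \<in> sph n" if x: "x \<in> sph n" for x
  proof -
    have xS: "x \<in> sph (Suc n)" using sph_mono[OF _ x] by simp
    then have "q x \<in> sph (Suc n)" using q by (auto simp: continuous_map_nsphere_iff)
    moreover have "q x (Suc n) = 0" using x by (simp add: q_def radial_def s_def sph_eq)
    ultimately show ?thesis by (auto simp: sph_eq) (metis Suc_lessI)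
  qed
  have "even (Brouwer_degree2 (Suc n) q - Brouwer_degree2 (Suc n - Suc 0) q)"
  proof (rule Borsuk_odd_mapping_degree_step[OF q])
    show "(q \<circ> (\<lambda>x i. - x i)) u = ((\<lambda>x i. - x i) \<circ> q) u" if "u \<in> sph (Suc n)" for u
      using q_minus[OF that] by (simp add: fun_Compl_def)
  qed (use q_eq in auto)
  moreover have "odd (Brouwer_degree2 n q)"
  proof (rule Suc.IH)
    show "n < DIM('a)" using Suc.prems by simp
    show "continuous_map (nsphere n) (nsphere n) q"
      using q q_eq continuous_on_subset[of "sph (Suc n)" q "sph n"] sph_mono[of n "Suc n"]
      by (auto simp: continuous_map_nsphere_iff)
    show "q (- x) = - q x" if "x \<in> sph n" for x
      using q_minus sph_mono[OF _ that] by simp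
  qed
  ultimately have "odd (Brouwer_degree2 (Suc n) q)" by simp
  also have "Brouwer_degree2 (Suc n) q = Brouwer_degree2 (Suc n) g"
    using nonantipodal_homotopic[OF g q q_g] by (metis Brouwer_degree2_homotopic)
  \<comment> \<open>An odd product has odd factors, so the degree of \<open>R\<close> need not be
    computed.\<close>
  also have "\<dots> = Brouwer_degree2 (Suc n) R * Brouwer_degree2 (Suc n) P"
    unfolding g_def by (rule Brouwer_degree2_compose[OF P R])
  also have "Brouwer_degree2 (Suc n) P = Brouwer_degree2 (Suc n) f"
    using nonantipodal_homotopic[OF Suc.prems(2) P P_na] by (metis Brouwer_degree2_homotopic)
  finally show ?case by simp
qed

text \<open>Normalizing a zero-free odd map gives an odd self-map of \<open>sph n\<close>, whose
  degree is odd. Its coordinate \<open>n\<close> vanishes because \<open>m \<le> n\<close>, so it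
  misses the pole and has degree zero, a contradiction.\<close>

theorem Borsuk_Ulam:
  assumes n: "n < DIM('a::euclidean_space)" and mn: "m \<le> n"
    and f: "continuous_map (nsphere n) (Euclidean_space m) f"
    and odd: "\<And>x. x \<in> sph n \<Longrightarrow> f (- x) = - f x"
  obtains x where "x \<in> sph n" "f x = (\<lambda>i. 0)"
proof (rule ccontr)
  assume "\<not> thesis"
  then have nz: "\<And>x. x \<in> sph n \<Longrightarrow> f x \<noteq> (\<lambda>i. 0)" using that by blast
  have fs: "f x i = 0" if "x \<in> sph n" "i \<ge> m" for x i
    using f that by (auto simp: continuous_map_def topspace_Euclidean_space Pi_iff)
  have fc: "continuous_on (sph n) f"
  proof -
    have "continuous_map (top_of_set (sph n)) euclidean f"
      using f unfolding Euclidean_space_def euclidean_product_topology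
      by (subst nsphere_eq_top_of_set[symmetric]) (auto dest: continuous_map_into_fulltopology)
    then show ?thesis by simp
  qed
  have nz': "\<exists>i\<le>n. f x i \<noteq> 0" if x: "x \<in> sph n" for x
  proof -
    obtain i where "f x i \<noteq> 0" using nz[OF x] by (auto simp: fun_eq_iff)
    then show ?thesis using fs[OF x, of i] mn by (meson le_trans nle_le)
  qed
  define h where "h = (\<lambda>x. radial n (f x))"
  have h: "continuous_map (nsphere n) (nsphere n) h"
    unfolding continuous_map_nsphere_iff h_def
  proof (intro conjI continuous_on_radial fc nz' funcsetI radial_in_sph)
    show "\<forall>i>n. f x i = 0" if "x \<in> sph n" for x using fs[OF that] mn by simp
  qed
  have "odd (Brouwer_degree2 n h)"
    by (rule Borsuk_odd_mapping_degree[OF n h]) (simp add: h_def odd radial_minus)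
  moreover have "h ` sph n \<noteq> sph n"
  proof
    assume "h ` sph n = sph n"
    moreover have "(\<lambda>i. if i = n then 1 else 0) \<in> sph n"
      by (simp add: sph_eq if_distrib[of "\<lambda>c. c\<^sup>2"] cong: if_cong)
    ultimately obtain x where x: "x \<in> sph n" and hx: "h x = (\<lambda>i. if i = n then 1 else 0)"
      by (metis (no_types, lifting) imageE)
    have "h x n = 0" using fs[OF x mn] by (simp add: h_def radial_def)
    then show False by (simp add: hx)
  qed
  ultimately show False using Brouwer_degree2_nonsurjective[OF h] by simp
qed

subsection \<open>Edge covers and independent sets of bipartite graphs\<close>

text \<open>Induction on the size of \<open>I\<close>. If some nonempty proper subset
  \<open>J\<close> is tight, \<open>J\<close> and its complement are matched separately; otherwise
  one element can be matched arbitrarily, since every other nonempty proper subset has a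
  surplus.\<close>

lemma hall_marriage:
  fixes A :: "'a \<Rightarrow> 'b set"
  assumes "finite I" "\<And>i. i \<in> I \<Longrightarrow> finite (A i)"
    and "\<And>J. J \<subseteq> I \<Longrightarrow> card J \<le> card (\<Union>(A ` J))"
  shows "\<exists>f. inj_on f I \<and> (\<forall>i\<in>I. f i \<in> A i)"
  using assms
proof (induction "card I" arbitrary: I A rule: less_induct)
  case less
  show ?case
  proof (cases "\<exists>J. J \<noteq> {} \<and> J \<subset> I \<and> card (\<Union>(A ` J)) = card J")
    case True
    then obtain J where J: "J \<noteq> {}" "J \<subset> I" "card (\<Union>(A ` J)) = card J" by blast
    have fJ: "finite J" using J less.prems(1) finite_subset by blast
    define U where "U = \<Union>(A ` J)"
    have fU: "finite U" unfolding U_def using fJ J less.prems(2) by auto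
    have "\<exists>f. inj_on f J \<and> (\<forall>i\<in>J. f i \<in> A i)"
    proof (rule less.hyps)
      show "card J < card I" using J less.prems(1) psubset_card_mono by blast
      show "card K \<le> card (\<Union>(A ` K))" if "K \<subseteq> J" for K
        using that J less.prems(3)[of K] by blast
    qed (use fJ J less.prems in auto)
    then obtain f where f: "inj_on f J" "\<And>i. i \<in> J \<Longrightarrow> f i \<in> A i" by blast
    have "\<exists>g. inj_on g (I - J) \<and> (\<forall>i\<in>I - J. g i \<in> A i - U)"
    proof (rule less.hyps)
      show "card (I - J) < card I"
        using J less.prems(1) by (intro psubset_card_mono) auto
      show "card K \<le> card (\<Union>i\<in>K. A i - U)" if K: "K \<subseteq> I - J" for K
      proof -
        have fK: "finite K" using K less.prems(1) finite_subset by blast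
        have fKU: "finite (\<Union>i\<in>K. A i - U)" using fK K less.prems(2) by auto
        \<comment> \<open>Hall's condition for \<open>K \<union> J\<close>, less the equality for
          the tight set \<open>J\<close>, is Hall's condition for \<open>K\<close> outside
          \<open>U\<close>.\<close>
        have "card K + card J = card (K \<union> J)"
          using fK fJ K by (intro card_Un_disjoint[symmetric]) auto
        also have "\<dots> \<le> card (\<Union>(A ` (K \<union> J)))"
          using K J by (intro less.prems(3)) auto
        also have "\<Union>(A ` (K \<union> J)) = (\<Union>i\<in>K. A i - U) \<union> U"
          by (auto simp: U_def)
        also have "card \<dots> = card (\<Union>i\<in>K. A i - U) + card U"
          using fKU fU by (intro card_Un_disjoint) auto
        finally show ?thesis using J(3) by (simp add: U_def)
      qed
    qed (use less.prems in auto)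
    then obtain g where g: "inj_on g (I - J)" "\<And>i. i \<in> I - J \<Longrightarrow> g i \<in> A i - U" by blast
    have "f ` J \<inter> g ` (I - J) = {}"
      using f(2) g(2) by (force simp: U_def)
    then have "inj_on (\<lambda>i. if i \<in> J then f i else g i) (J \<union> (I - J))"
      by (rule inj_on_disjoint_Un[OF f(1) g(1)])
    moreover have "J \<union> (I - J) = I" using J by blast
    ultimately have "inj_on (\<lambda>i. if i \<in> J then f i else g i) I" by simp
    then show ?thesis using f(2) g(2) by (intro exI[of _ "\<lambda>i. if i \<in> J then f i else g i"]) auto
  next
    case False
    show ?thesis
    proof (cases "I = {}")
      case True
      then show ?thesis by simp
    next
      case False': False
      then obtain x where x: "x \<in> I" by blast
      have "card {x} \<le> card (\<Union>(A ` {x}))" using x by (intro less.prems(3)) auto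
      then obtain y where y: "y \<in> A x" by fastforce
      have "\<exists>f. inj_on f (I - {x}) \<and> (\<forall>i\<in>I - {x}. f i \<in> A i - {y})"
      proof (rule less.hyps)
        show "card (I - {x}) < card I" using less.prems(1) x by (rule card_Diff1_less)
        show "card K \<le> card (\<Union>i\<in>K. A i - {y})" if K: "K \<subseteq> I - {x}" for K
        proof (cases "K = {}")
          case Kne: False
          have "card K \<le> card (\<Union>(A ` K))" using K less.prems(3)[of K] by blast
          moreover have "card (\<Union>(A ` K)) \<noteq> card K" using False K x Kne by blast
          \<comment> \<open>The strictness pays for the removal of \<open>y\<close>.\<close>
          ultimately have "card K < card (\<Union>(A ` K))" by simp
          moreover have "(\<Union>i\<in>K. A i - {y}) = \<Union>(A ` K) - {y}" by auto
          ultimately show ?thesis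
            using diff_card_le_card_Diff[of "{y}" "\<Union>(A ` K)"] by simp
        qed auto
      qed (use less.prems in auto)
      then obtain f where f: "inj_on f (I - {x})" "\<And>i. i \<in> I - {x} \<Longrightarrow> f i \<in> A i - {y}" by blast
      have "inj_on (f(x := y)) I"
        using f by (auto simp: inj_on_def)
      then show ?thesis using f(2) y by (intro exI[of _ "f(x := y)"]) auto
    qed
  qed
qed

definition neighbours :: "('n::finite) set set \<Rightarrow> 'n \<Rightarrow> 'n set" where
  "neighbours E i = {j. {i, j} \<in> E}"

text \<open>With \<open>d\<close> the largest deficiency \<open>card X - card (N X)\<close> over
  subsets \<open>X\<close> of \<open>L\<close>, there is an independent set of size
  \<open>card R + d\<close>, and a matching leaving at most \<open>d\<close> vertices of
  \<open>L\<close> free extends to an edge cover of at most that size.\<close>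

lemma independent_cover_bipartite:
  fixes E :: "('n::finite) set set"
  assumes nov: "no_isolated_vertices E" and bip: "bipartite E"
  shows "\<exists>S F. independent_set E S \<and> edge_cover E F \<and> card F \<le> card S"
proof -
  obtain L R where LR: "L \<union> R = UNIV" "L \<inter> R = {}" and E': "\<forall>e\<in>E. \<exists>i\<in>L. \<exists>j\<in>R. e = {i, j}"
    using bip unfolding bipartite_def by (elim exE conjE) (rule that)
  note E = bspec[OF E']
  define N where "N = (\<lambda>X. \<Union>(neighbours E ` X))"
  have NR: "N X \<subseteq> R" if "X \<subseteq> L" for X
  proof
    fix j assume "j \<in> N X"
    then obtain i where i: "i \<in> X" "{i, j} \<in> E" by (auto simp: N_def neighbours_def)
    with E[OF i(2)] that LR show "j \<in> R" by (auto simp: doubleton_eq_iff)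
  qed
  define dd where "dd = (\<lambda>X. card X - card (N X))"
  define d where "d = Max (dd ` Pow L)"
  have dmax: "dd X \<le> d" if "X \<subseteq> L" for X
    unfolding d_def using that by (intro Max_ge) auto
  have "d \<in> dd ` Pow L" unfolding d_def by (intro Max_in) auto
  then obtain X where X: "X \<subseteq> L" "dd X = d" by auto
  text \<open>If \<open>d = 0\<close>, the truncated subtraction in \<open>dd\<close> may hide that \<open>X\<close> has too many neighbours.\<close>
  define S where "S = (if d = 0 then R else X \<union> (R - N X))"
  have indR: "independent_set E R"
    unfolding independent_set_def using E LR by (fastforce simp: doubleton_eq_iff)
  have indX: "independent_set E (X \<union> (R - N X))"
    unfolding independent_set_def
  proof (intro ballI notI)
    fix i j assume ij: "i \<in> X \<union> (R - N X)" "j \<in> X \<union> (R - N X)" "{i, j} \<in> E"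
    then have "{j, i} \<in> E" by (simp add: insert_commute)
    then show False
      using ij E[OF ij(3)] X LR by (auto simp: N_def neighbours_def doubleton_eq_iff)
  qed
  have indS: "independent_set E S" using indR indX by (simp add: S_def)
  have cardS: "card S = card R + d"
  proof (cases "d = 0")
    case False
    have "card (X \<union> (R - N X)) = card X + (card R - card (N X))"
      using X LR NR[OF X(1)] by (subst card_Un_disjoint) (auto simp: card_Diff_subset)
    moreover have "card (N X) \<le> card R" using NR[OF X(1)] by (intro card_mono) auto
    ultimately show ?thesis using False X(2) by (simp add: S_def dd_def)
  qed (simp add: S_def)
  text \<open>Adding \<open>d\<close> dummy partners to every vertex of \<open>L\<close> restores Hall's condition.\<close>
  define D where "D = (Inr ` {..<d} :: ('n + nat) set)"
  define A where "A = (\<lambda>i. Inl ` neighbours E i \<union> D)"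
  have cD: "card D = d" "finite D" by (auto simp: D_def card_image)
  have "\<exists>f. inj_on f L \<and> (\<forall>i\<in>L. f i \<in> A i)"
  proof (rule hall_marriage)
    show "card J \<le> card (\<Union>(A ` J))" if "J \<subseteq> L" for J
    proof (cases "J = {}")
      case False
      then have "\<Union>(A ` J) = Inl ` N J \<union> D" by (auto simp: A_def N_def)
      also have "card \<dots> = card (N J) + d"
        using cD by (subst card_Un_disjoint) (auto simp: D_def card_image)
      finally show ?thesis using dmax[OF that] by (simp add: dd_def)
    qed simp
  qed (auto simp: A_def cD)
  then obtain f where f: "inj_on f L" "\<And>i. i \<in> L \<Longrightarrow> f i \<in> A i" by blast
  have "\<exists>e\<in>E. v \<in> e" for v using nov by (simp add: no_isolated_vertices_def)
  then obtain c where c: "\<And>v. c v \<in> E" "\<And>v. v \<in> c v" by metis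
  \<comment> \<open>A vertex of \<open>L\<close> with a genuine partner takes the matching edge, one
    with a dummy partner any incident edge; the unmatched vertices of \<open>R\<close> also take any
    incident edge.\<close>
  define ce where "ce = (\<lambda>i. case f i of Inl j \<Rightarrow> {i, j} | Inr _ \<Rightarrow> c i)"
  define M where "M = {i \<in> L. \<exists>j. f i = Inl j}"
  define R' where "R' = (\<lambda>i. projl (f i)) ` M"
  define F where "F = ce ` L \<union> c ` (R - R')"
  have ceE: "ce i \<in> E \<and> i \<in> ce i" if "i \<in> L" for i
    using f(2)[OF that] c by (auto simp: ce_def A_def D_def neighbours_def split: sum.splits)
  have "v \<in> \<Union>F" for v
  proof -
    consider "v \<in> L" | "v \<in> R - R'" | "v \<in> R'" using LR by blast
    then show ?thesis
    proof cases
      case 3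
      then obtain i where "i \<in> L" "f i = Inl v" by (auto simp: R'_def M_def)
      then show ?thesis by (auto simp: F_def ce_def intro!: bexI[of _ i])
    next
      case 1
      then show ?thesis using ceE by (auto simp: F_def)
    next
      case 2
      then have "c v \<in> F" by (simp add: F_def)
      then show ?thesis using c(2) by blast
    qed
  qed
  moreover have "F \<subseteq> E" using ceE c by (auto simp: F_def)
  ultimately have cover: "edge_cover E F" unfolding edge_cover_def by blast
  \<comment> \<open>Vertices outside \<open>M\<close> have distinct dummy partners, so there are at
    most \<open>d\<close> of them.\<close>
  have "f ` (L - M) \<subseteq> D" using f(2) by (fastforce simp: M_def A_def)
  then have "card (L - M) \<le> d"
    using cD card_inj_on_le[of f "L - M" D] f(1) inj_on_diff by blast
  moreover have "card L = card M + card (L - M)"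
    by (simp add: M_def card_Diff_subset card_mono)
  moreover have "card R' = card M"
    unfolding R'_def
  proof (rule card_image, rule inj_onI)
    fix x y assume "x \<in> M" "y \<in> M" "projl (f x) = projl (f y)"
    then have "f x = f y" by (auto simp: M_def)
    then show "x = y" using f(1) \<open>x \<in> M\<close> \<open>y \<in> M\<close> by (auto simp: M_def inj_on_def)
  qed
  moreover have "R' \<subseteq> R"
    using f(2) NR[of L] by (fastforce simp: R'_def M_def A_def D_def N_def)
  moreover have "card F \<le> card L + card (R - R')"
    unfolding F_def by (meson add_mono card_Un_le card_image_le finite order_trans)
  moreover have "card (R - R') = card R - card R'" "card R' \<le> card R"
    using \<open>R' \<subseteq> R\<close> by (auto simp: card_Diff_subset card_mono)
  ultimately have "card F \<le> card S" using cardS by linarith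
  then show ?thesis using indS cover by blast
qed

subsection \<open>Genus and min-max eigenvalues\<close>

definition weighted_norm :: "('n::finite) set set \<Rightarrow> real ^ 'n \<Rightarrow> real" where
  "weighted_norm E x = (\<Sum>i\<in>UNIV. real (Defs.degree E i) * \<bar>x $ i\<bar>)"

lemma X_set_iff: "x \<in> X_set E \<longleftrightarrow> weighted_norm E x = 1"
  by (simp add: X_set_def weighted_norm_def)

text \<open>Double counting of incidences; this form can be compared with \<open>I_plus\<close> edge
  by edge.\<close>

lemma weighted_norm_eq_edge_sum: "weighted_norm E x = (\<Sum>e\<in>E. \<Sum>i\<in>e. \<bar>x $ i\<bar>)"
proof -
  have "weighted_norm E x = (\<Sum>i\<in>UNIV. \<Sum>e\<in>{e\<in>E. i \<in> e}. \<bar>x $ i\<bar>)"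
    by (simp add: weighted_norm_def Defs.degree_def)
  also have "\<dots> = (\<Sum>e\<in>E. \<Sum>i\<in>{i\<in>UNIV. i \<in> e}. \<bar>x $ i\<bar>)"
    by (rule sum.swap_restrict) auto
  finally show ?thesis by simp
qed

lemma weighted_norm_minus: "weighted_norm E (- x) = weighted_norm E x"
  by (simp add: weighted_norm_def)

lemma eq_uminus_image:
  fixes A :: "'a::group_add set"
  assumes "\<And>x. x \<in> A \<Longrightarrow> - x \<in> A"
  shows "A = uminus ` A"
proof
  show "A \<subseteq> uminus ` A"
    using assms by (metis image_eqI minus_minus subsetI)
qed (use assms in auto)

lemma weighted_norm_scaleR: "weighted_norm E (c *\<^sub>R x) = \<bar>c\<bar> * weighted_norm E x"
  by (simp add: weighted_norm_def abs_mult sum_distrib_left mult.left_commute)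

lemma continuous_on_weighted_norm: "continuous_on A (weighted_norm E)"
  unfolding weighted_norm_def by (intro continuous_intros)

lemma continuous_on_I_plus: "continuous_on A (I_plus E)"
  unfolding I_plus_def by (intro continuous_intros)

text \<open>All degrees are at least one. This bounds \<open>X_set\<close> and makes the weighted
  norm positive away from zero.\<close>

lemma norm_le_weighted_norm:
  assumes "no_isolated_vertices E"
  shows "norm x \<le> weighted_norm E x"
proof -
  have "Defs.degree E i \<ge> 1" for i
  proof -
    have "{e \<in> E. i \<in> e} \<noteq> {}" using assms by (auto simp: no_isolated_vertices_def)
    then show ?thesis by (simp add: Defs.degree_def Suc_leI card_gt_0_iff)
  qed
  then have "\<bar>x $ i\<bar> \<le> real (Defs.degree E i) * \<bar>x $ i\<bar>" for i
    by (simp add: mult_le_cancel_right1)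
  then show ?thesis
    unfolding weighted_norm_def by (intro order_trans[OF norm_le_l1_cart] sum_mono)
qed

lemma I_plus_le_weighted_norm: "I_plus E x \<le> weighted_norm E x"
  unfolding I_plus_def weighted_norm_eq_edge_sum by (intro sum_mono sum_abs)

lemma I_plus_le_1: "x \<in> X_set E \<Longrightarrow> I_plus E x \<le> 1"
  using I_plus_le_weighted_norm[of E x] by (simp add: X_set_iff)

lemma I_plus_nonneg: "0 \<le> I_plus E x"
  by (simp add: I_plus_def sum_nonneg)

lemma bdd_above_I_plus: "A \<subseteq> X_set E \<Longrightarrow> bdd_above (I_plus E ` A)"
  by (intro bdd_aboveI2[of _ _ 1]) (auto intro: I_plus_le_1)

lemma compact_X_set:
  assumes "no_isolated_vertices E"
  shows "compact (X_set E)"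
proof -
  have "X_set E = weighted_norm E -` {1}" by (auto simp: X_set_iff)
  then have "closed (X_set E)"
    using continuous_closed_vimage[of "{1}" "weighted_norm E"] continuous_on_weighted_norm[of UNIV E]
    by (simp add: continuous_on_eq_continuous_at)
  moreover have "X_set E \<subseteq> cball 0 1"
  proof
    fix x assume "x \<in> X_set E"
    then show "x \<in> cball 0 1" using norm_le_weighted_norm[OF assms, of x] by (simp add: X_set_iff)
  qed
  ultimately show ?thesis by (meson bounded_cball bounded_subset compact_eq_bounded_closed)
qed

section \<open>Bounds for the genus\<close>

lemma genus_le: "odd_map_to_punctured_space A m \<Longrightarrow> genus A \<le> enat m"
  unfolding genus_def by (intro Inf_lower) auto

text \<open>Keeps the empty set, which maps vacuously into dimension zero, out of the real
  suprema.\<close>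

lemma nonempty_if_genus_pos:
  assumes "enat k \<le> genus A" "0 < k"
  shows "A \<noteq> {}"
proof
  assume "A = {}"
  then have "odd_map_to_punctured_space A 0"
    by (simp add: odd_map_to_punctured_space_def)
  from order_trans[OF assms(1) genus_le[OF this]] show False using assms(2) by simp
qed

text \<open>Rescaling maps the unit sphere of \<open>W\<close> oddly into
  \<open>W \<inter> X_set E\<close>. If \<open>dim W = n + 1\<close>, this sphere is a copy of
  \<open>sph n\<close>, so an odd zero-free map into dimension \<open>m \<le> n\<close> would
  contradict \<open>Borsuk_Ulam\<close>.\<close>

lemma subspace_X_set_genus_ge:
  fixes W :: "(real ^ 'n::finite) set"
  assumes nov: "no_isolated_vertices E" and W: "subspace W"
  shows "enat (dim W) \<le> genus (W \<inter> X_set E)"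
  unfolding genus_def
proof (intro Inf_greatest, elim imageE)
  fix k m
  assume k: "k = enat m" and m: "m \<in> {m. odd_map_to_punctured_space (W \<inter> X_set E) m}"
  have "dim W \<le> m"
  proof (rule ccontr)
    assume "\<not> dim W \<le> m"
    then obtain n where n: "dim W = Suc n" "m \<le> n" by (cases "dim W") auto
    obtain f where f: "continuous_map (top_of_set (W \<inter> X_set E)) (Euclidean_space m) f"
      and fnz: "\<And>x. x \<in> W \<inter> X_set E \<Longrightarrow> f x \<noteq> (\<lambda>i. 0)"
      and fodd: "\<And>x. x \<in> W \<inter> X_set E \<Longrightarrow> f (- x) = (\<lambda>i. - f x i)"
      using m by (auto simp: odd_map_to_punctured_space_def)
    obtain B where B: "B \<subseteq> W" "pairwise orthogonal B" "\<And>x. x \<in> B \<Longrightarrow> norm x = 1"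
      "independent B" "card B = dim W"
      using orthonormal_basis_subspace[OF W] by metis
    have "finite B" using B(4) independent_imp_finite by blast
    then obtain b where b: "bij_betw b {0..<Suc n} B"
      using ex_bij_betw_nat_finite[of B] B(5) n(1) by auto
    have bW: "b i \<in> W" if "i \<le> n" for i using b that B(1) by (auto simp: bij_betw_def)
    have bb: "b i \<bullet> b j = (if i = j then 1 else 0)" if ij: "i \<le> n" "j \<le> n" for i j
    proof -
      have bi: "b i \<in> B" "b j \<in> B" using b ij by (auto simp: bij_betw_def)
      show ?thesis
      proof (cases "i = j")
        case True
        then show ?thesis using B(3)[OF bi(1)] by (simp add: dot_square_norm)
      next
        case False
        then have "b i \<noteq> b j" using b ij by (auto simp: bij_betw_def inj_on_def)
        then show ?thesis using B(2) bi False by (auto simp: pairwise_def orthogonal_def)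
      qed
    qed
    \<comment> \<open>\<open>L\<close> identifies \<open>sph n\<close> with the unit sphere of
      \<open>W\<close>; \<open>g\<close> below rescales the result to weighted norm one.\<close>
    define L where "L = (\<lambda>y. \<Sum>i\<le>n. y i *\<^sub>R b i)"
    have Lb: "L y \<bullet> b j = y j" if "j \<le> n" for y j
    proof -
      have "L y \<bullet> b j = (\<Sum>i\<le>n. if i = j then y i else 0)"
        unfolding L_def inner_sum_left using that by (intro sum.cong) (auto simp: bb)
      then show ?thesis using that by simp
    qed
    have LW: "L y \<in> W" for y
      unfolding L_def using bW by (intro subspace_sum[OF W] subspace_scale[OF W]) auto
    have Lm: "L (- y) = - L y" for y by (simp add: L_def sum_negf)
    have L0: "L y \<noteq> 0" if y: "y \<in> sph n" for y
    proof
      assume "L y = 0"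
      then have "y j = 0" if "j \<le> n" for j using Lb[OF that, of y] by simp
      then show False using sph_nonzero[OF y] by blast
    qed
    have Lp: "weighted_norm E (L y) > 0" if "y \<in> sph n" for y
      using L0[OF that] norm_le_weighted_norm[OF nov, of "L y"] by (meson less_le_trans zero_less_norm_iff)
    define g where "g = (\<lambda>y. inverse (weighted_norm E (L y)) *\<^sub>R L y)"
    have gA: "g y \<in> W \<inter> X_set E" if "y \<in> sph n" for y
      using Lp[OF that] LW by (simp add: g_def X_set_iff weighted_norm_scaleR subspace_scale[OF W])
    have gm: "g (- y) = - g y" for y
      by (simp add: g_def Lm weighted_norm_minus)
    have Lc: "continuous_on (sph n) L"
      unfolding L_def by (intro continuous_intros continuous_on_product_then_coordinatewise[OF continuous_on_id])
    have "continuous_on (sph n) (\<lambda>y. weighted_norm E (L y))"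
      by (rule continuous_on_compose2[OF continuous_on_weighted_norm Lc subset_UNIV])
    then have "continuous_on (sph n) g"
      unfolding g_def using Lp Lc by (intro continuous_intros) (auto simp: less_imp_neq[symmetric])
    then have "continuous_map (nsphere n) (top_of_set (W \<inter> X_set E)) g"
      using gA by (subst nsphere_eq_top_of_set) (auto simp: image_subset_iff)
    from continuous_map_compose[OF this f]
    have fg: "continuous_map (nsphere n) (Euclidean_space m) (f \<circ> g)" .
    \<comment> \<open>\<open>real ^ 'n\<close> itself serves as the Euclidean space that
      \<open>Borsuk_Ulam\<close> asks for.\<close>
    have "n < DIM(real ^ 'n)" using dim_subset_UNIV[of W] n(1) by simp
    then obtain y where "y \<in> sph n" "(f \<circ> g) y = (\<lambda>i. 0)"
    proof (rule Borsuk_Ulam[OF _ n(2) fg])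
      show "(f \<circ> g) (- y) = - (f \<circ> g) y" if "y \<in> sph n" for y
      proof -
        have "(f \<circ> g) (- y) = f (- g y)" by (simp add: gm)
        also have "\<dots> = - (f \<circ> g) y" using fodd[OF gA[OF that]] by (simp add: fun_Compl_def)
        finally show ?thesis .
      qed
    qed
    then show False using fnz gA by auto
  qed
  then show "enat (dim W) \<le> k" by (simp add: k)
qed

lemma genus_le_if_coordinates_nonzero:
  fixes A :: "(real ^ 'n::finite) set"
  assumes "\<And>x. x \<in> A \<Longrightarrow> \<exists>i\<in>C. x $ i \<noteq> 0"
  shows "genus A \<le> enat (card C)"
proof (rule genus_le)
  obtain h where h: "bij_betw h {0..<card C} C"
    using ex_bij_betw_nat_finite[of C] by auto
  let ?f = "\<lambda>(x::real ^ 'n) i. if i < card C then x $ h i else 0"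
  have "continuous_map (top_of_set A) (Euclidean_space (card C)) ?f"
    unfolding continuous_map_componentwise_Euclidean_space
    by (simp add: continuous_on_component)
  moreover have "?f x \<noteq> (\<lambda>i. 0)" if x: "x \<in> A" for x
  proof -
    obtain i where "i \<in> C" "x $ i \<noteq> 0" using assms[OF x] by blast
    moreover then obtain j where "j < card C" "h j = i"
      using h unfolding bij_betw_def by (metis atLeastLessThan_iff imageE)
    ultimately show ?thesis by (auto simp: fun_eq_iff)
  qed
  moreover have "?f (- x) = (\<lambda>i. - ?f x i)" for x by auto
  ultimately show "odd_map_to_punctured_space A (card C)"
    unfolding odd_map_to_punctured_space_def by blast
qed

section \<open>Min-max values equal to 1 and below 1\<close>

lemma I_plus_eq_weighted_norm:
  assumes simple: "simple_graph E" and ind: "independent_set E S"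
    and supp: "\<And>i. i \<notin> S \<Longrightarrow> x $ i = 0"
  shows "I_plus E x = weighted_norm E x"
  unfolding I_plus_def weighted_norm_eq_edge_sum
proof (rule sum.cong[OF refl])
  fix e assume e: "e \<in> E"
  then have "card e = 2" using simple by (simp add: simple_graph_def)
  then obtain i j where ij: "e = {i, j}" "i \<noteq> j" by (auto simp: card_2_iff)
  \<comment> \<open>At most one endpoint of each edge lies in the support, so nothing
    cancels.\<close>
  then have "i \<notin> S \<or> j \<notin> S" using ind e by (auto simp: independent_set_def)
  then have "x $ i = 0 \<or> x $ j = 0" using supp by blast
  then show "\<bar>\<Sum>i\<in>e. x $ i\<bar> = (\<Sum>i\<in>e. \<bar>x $ i\<bar>)" using ij by auto
qed

text \<open>Every admissible set contains a point supported in \<open>S\<close>, so its supremum is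
  at least 1; \<open>X_set E\<close> is itself admissible and attains 1.\<close>

lemma minmax_eigenvalue_eq_1:
  fixes E :: "('n::finite) set set"
  assumes simple: "simple_graph E" and nov: "no_isolated_vertices E"
    and ind: "independent_set E S" and k: "CARD('n) - card S < k" "k \<le> CARD('n)"
  shows "minmax_eigenvalue E k = 1"
  unfolding minmax_eigenvalue_def
proof (rule cInf_eq_minimum)
  have ge: "1 \<le> Sup (I_plus E ` A)" if A: "A \<subseteq> X_set E" "enat k \<le> genus A" for A
  proof -
    have "\<not> (\<forall>x\<in>A. \<exists>i\<in>-S. x $ i \<noteq> 0)"
    proof
      assume "\<forall>x\<in>A. \<exists>i\<in>-S. x $ i \<noteq> 0"
      then have "genus A \<le> enat (card (- S))" by (intro genus_le_if_coordinates_nonzero) blast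
      with A(2) have "enat k \<le> enat (card (- S))" by (rule order_trans)
      then show False using k by (simp add: Compl_eq_Diff_UNIV card_Diff_subset)
    qed
    then obtain x where x: "x \<in> A" "\<And>i. i \<notin> S \<Longrightarrow> x $ i = 0" by blast
    then have "I_plus E x = 1"
      using I_plus_eq_weighted_norm[OF simple ind x(2)] A(1) by (auto simp: X_set_iff)
    then show ?thesis
      using cSup_upper[OF imageI[OF x(1)] bdd_above_I_plus[OF A(1)]] by simp
  qed
  show "1 \<le> y" if "y \<in> {Sup (I_plus E ` A) |A. A \<subseteq> X_set E \<and> compact A \<and> A = uminus ` A \<and> enat k \<le> genus A}" for y
    using that ge by blast
  have "enat k \<le> enat (dim (UNIV :: (real ^ 'n) set))" using k by simp
  also have "\<dots> \<le> genus (X_set E)"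
    using subspace_X_set_genus_ge[OF nov subspace_UNIV] by simp
  finally have gX: "enat k \<le> genus (X_set E)" .
  then have "X_set E \<noteq> {}" using nonempty_if_genus_pos k(1) by fastforce
  then have "Sup (I_plus E ` X_set E) \<le> 1"
    using I_plus_le_1 by (intro cSup_least) auto
  then have "1 = Sup (I_plus E ` X_set E)" using ge[OF order_refl gX] by simp
  moreover have "X_set E = uminus ` X_set E"
    by (rule eq_uminus_image) (simp add: X_set_iff weighted_norm_minus)
  ultimately show "1 \<in> {Sup (I_plus E ` A) |A. A \<subseteq> X_set E \<and> compact A \<and> A = uminus ` A \<and> enat k \<le> genus A}"
    using compact_X_set[OF nov] gX by (intro CollectI exI[of _ "X_set E"] conjI) simp_all
qed

text \<open>The edges in \<open>F\<close> impose \<open>card F\<close> linear equations, leaving a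
  subspace of dimension at least \<open>k\<close>. By compactness the supremum on its section is a
  maximum, so strict inequality at each point suffices.\<close>

lemma minmax_eigenvalue_less_1:
  fixes E :: "('n::finite) set set"
  assumes simple: "simple_graph E" and nov: "no_isolated_vertices E"
    and cover: "edge_cover E F" and k: "0 < k" "k \<le> CARD('n) - card F"
  shows "minmax_eigenvalue E k < 1"
proof -
  define W where "W = {x :: real ^ 'n. \<forall>e\<in>F. (\<Sum>i\<in>e. x $ i) = 0}"
  have W: "subspace W"
    by (auto simp: W_def subspace_def sum.distrib simp flip: sum_distrib_left)
  \<comment> \<open>Indicator vectors of the edges in \<open>F\<close>; the orthogonal complement of
    their span lies in \<open>W\<close>.\<close>
  define V where "V = (\<lambda>e. (\<chi> i. if i \<in> e then 1 else 0) :: real ^ 'n) ` F"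
  have "dim V \<le> card F"
    unfolding V_def by (meson card_image_le dim_le_card' finite finite_imageI order_trans)
  moreover have "dim {y \<in> UNIV. \<forall>x\<in>span V. orthogonal x y} + dim (span V) = CARD('n)"
    using dim_subspace_orthogonal_to_vectors[of "span V" UNIV] by simp
  moreover have "{y \<in> UNIV. \<forall>x\<in>span V. orthogonal x y} \<subseteq> W"
  proof
    fix y assume y: "y \<in> {y \<in> UNIV. \<forall>x\<in>span V. orthogonal x y}"
    have "(\<Sum>i\<in>e. y $ i) = 0" if "e \<in> F" for e
    proof -
      have "orthogonal (\<chi> i. if i \<in> e then 1 else 0) y"
        using y that by (auto simp: V_def intro!: span_base)
      then show ?thesis
        by (simp add: orthogonal_def inner_vec_def if_distrib[of "\<lambda>c. c * _"] sum.If_cases cong: if_cong)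
    qed
    then show "y \<in> W" by (simp add: W_def)
  qed
  then have "dim {y \<in> UNIV. \<forall>x\<in>span V. orthogonal x y} \<le> dim W" by (rule dim_subset)
  ultimately have "k \<le> dim W" using k(2) by (simp add: dim_span)
  define A where "A = W \<inter> X_set E"
  have "enat k \<le> enat (dim W)" using \<open>k \<le> dim W\<close> by simp
  also have "\<dots> \<le> genus A" unfolding A_def by (rule subspace_X_set_genus_ge[OF nov W])
  finally have gA: "enat k \<le> genus A" .
  then have "A \<noteq> {}" using nonempty_if_genus_pos k(1) by blast
  have compA: "compact A"
    unfolding A_def using compact_X_set[OF nov] closed_subspace[OF W] by (simp add: closed_Int_compact)
  obtain x where x: "x \<in> A" "\<And>y. y \<in> A \<Longrightarrow> I_plus E y \<le> I_plus E x"
    using continuous_attains_sup[OF compA \<open>A \<noteq> {}\<close> continuous_on_I_plus] by blast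
  have "Sup (I_plus E ` A) = I_plus E x"
    using x by (intro cSup_eq_maximum) auto
  also have "\<dots> < weighted_norm E x"
  proof -
    have "x \<noteq> 0" using x(1) by (auto simp: A_def X_set_iff weighted_norm_def)
    then obtain v where v: "x $ v \<noteq> 0" by (auto simp: vec_eq_iff)
    have "v \<in> \<Union>F" using cover by (simp add: edge_cover_def)
    then obtain e where e: "e \<in> F" "v \<in> e" by (elim UnionE)
    \<comment> \<open>The edge covering a nonzero coordinate adds nothing to \<open>I_plus\<close>
      but a positive amount to the weighted norm.\<close>
    have "\<bar>\<Sum>i\<in>e. x $ i\<bar> = 0" using x(1) e by (simp add: A_def W_def)
    also have "0 < (\<Sum>i\<in>e. \<bar>x $ i\<bar>)" using v e by (intro sum_pos2[of _ v]) auto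
    finally have "\<bar>\<Sum>i\<in>e. x $ i\<bar> < (\<Sum>i\<in>e. \<bar>x $ i\<bar>)" .
    moreover have "e \<in> E" using cover e by (auto simp: edge_cover_def)
    ultimately show ?thesis
      unfolding I_plus_def weighted_norm_eq_edge_sum
      by (intro sum_strict_mono_ex1 ballI sum_abs bexI[of _ e]) auto
  qed
  also have "\<dots> = 1" using x(1) by (simp add: A_def X_set_iff)
  finally have "Sup (I_plus E ` A) < 1" .
  moreover have "minmax_eigenvalue E k \<le> Sup (I_plus E ` A)"
    unfolding minmax_eigenvalue_def
  proof (rule cInf_lower)
    have "- y \<in> A" if "y \<in> A" for y
      using that subspace_neg[OF W] by (auto simp: A_def X_set_iff weighted_norm_minus)
    then have "A = uminus ` A" by (rule eq_uminus_image)
    then show "Sup (I_plus E ` A) \<in> {Sup (I_plus E ` A) |A. A \<subseteq> X_set E \<and> compact A \<and> A = uminus ` A \<and> enat k \<le> genus A}"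
      using compA gA A_def by (intro CollectI exI[of _ A] conjI) simp_all
    have "0 \<le> Sup (I_plus E ` B)" if "B \<subseteq> X_set E" "enat k \<le> genus B" for B
    proof -
      have "B \<noteq> {}" using that nonempty_if_genus_pos k(1) by blast
      then obtain z where "z \<in> B" by blast
      then show ?thesis
        using I_plus_nonneg cSup_upper[OF imageI bdd_above_I_plus[OF that(1)]] by (meson order_trans)
    qed
    then show "bdd_below {Sup (I_plus E ` A) |A. A \<subseteq> X_set E \<and> compact A \<and> A = uminus ` A \<and> enat k \<le> genus A}"
      by (intro bdd_belowI[of _ 0]) auto
  qed
  ultimately show ?thesis by linarith
qed

theorem theorem3p11:
  fixes E :: "('n::finite) set set"
  assumes "simple_graph E"
    and "no_isolated_vertices E"
  shows "(independence_number E \<le> multiplicity_minmax E 1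
            \<and> multiplicity_minmax E 1 \<le> edge_covering_number E)
         \<and> (connected_graph E \<and> bipartite E \<longrightarrow> multiplicity_minmax E 1 = independence_number E)"
proof (intro conjI impI)
  let ?K = "{k \<in> {1..CARD('n)}. minmax_eigenvalue E k = 1}"
  have "independent_set E {}" by (simp add: independent_set_def)
  then have "independence_number E \<in> card ` {S. independent_set E S}"
    unfolding independence_number_def by (intro Max_in) auto
  then obtain S where S: "independent_set E S" "card S = independence_number E" by auto
  \<comment> \<open>Ensures that the minimum is over a nonempty family and hence attained.\<close>
  have "edge_cover E E" using assms(2) by (auto simp: edge_cover_def no_isolated_vertices_def)
  then have "edge_covering_number E \<in> card ` {F. edge_cover E F}"
    unfolding edge_covering_number_def by (intro Min_in) auto
  then obtain F where F: "edge_cover E F" "card F = edge_covering_number E" by auto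
  \<comment> \<open>Thus the subtraction below is not truncated, and the interval has exactly
    \<open>card S\<close> elements.\<close>
  have "card S \<le> CARD('n)" by (intro card_mono) auto
  moreover have "{CARD('n) - card S + 1..CARD('n)} \<subseteq> ?K"
    using minmax_eigenvalue_eq_1[OF assms S(1)] by auto
  then have "card {CARD('n) - card S + 1..CARD('n)} \<le> card ?K" by (intro card_mono) auto
  ultimately show lower: "independence_number E \<le> multiplicity_minmax E 1"
    unfolding multiplicity_minmax_def S(2)[symmetric] by simp
  have "?K \<subseteq> {CARD('n) - card F + 1..CARD('n)}"
  proof
    fix k assume k: "k \<in> ?K"
    then have "\<not> k \<le> CARD('n) - card F"
      using minmax_eigenvalue_less_1[OF assms F(1), of k] by auto
    then show "k \<in> {CARD('n) - card F + 1..CARD('n)}" using k by auto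
  qed
  then have "card ?K \<le> card {CARD('n) - card F + 1..CARD('n)}" by (intro card_mono) auto
  then show upper: "multiplicity_minmax E 1 \<le> edge_covering_number E"
    unfolding multiplicity_minmax_def F(2)[symmetric] by simp
  assume "connected_graph E \<and> bipartite E"
  \<comment> \<open>The chain \<open>card S'\<close> \<le> independence number \<le> multiplicity
    \<le> edge covering number \<le> \<open>card F'\<close> \<le> \<open>card S'\<close> collapses
    to equalities.\<close>
  then obtain S' F' where "independent_set E S'" "edge_cover E F'" "card F' \<le> card S'"
    using independent_cover_bipartite[OF assms(2)] by blast
  moreover from this have "card S' \<le> independence_number E" "edge_covering_number E \<le> card F'"
    unfolding independence_number_def edge_covering_number_def by (auto intro: Max_ge Min_le)
  ultimately show "multiplicity_minmax E 1 = independence_number E"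
    using lower upper by linarith
qed

end
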